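(* Let $\mathbb K\in\{\mathbb R,\mathbb C\}$ and let $V=(\mathbb K^{\dim V},\langle\cdot,R_V\cdot\rangle)$ and $W=(\mathbb K^{\dim W},\langle\cdot,R_W\cdot\rangle)$ be finite-dimensional Hilbert spaces, where $R_V$, $R_W$ are self-adjoint positive definite matrices. Let $Q_V\in\mathbb K^{p\times\dim V}$ and $Q_W\in\mathbb K^{q\times\dim W}$ be such that $Q_V^*Q_V=R_V$ and $Q_W^*Q_W=R_W$. If $\Upsilon$ is a $(\varepsilon,\delta,d)$ oblivious $\mathbb K^{q\times p}\to\mathbb K^k$ subspace embedding, then $$\Theta:\ G\mapsto\Upsilon\big(Q_W\,G\,R_V^{-1}Q_V^*\big)$$ is a $(\varepsilon,\delta,d)$ oblivious $HS(V,W)\to\mathbb K^k$ subspace embedding.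
   Context: $M^*$ is the conjugate transpose; the inner products are $\langle v_1,v_2\rangle_V=v_1^*R_Vv_2$ and $\langle w_1,w_2\rangle_W=w_1^*R_Ww_2$. $HS(V,W)$ is the space $\mathbb K^{\dim W\times\dim V}$ of linear operators $V\to W$ with the Hilbert--Schmidt inner product $\langle G_1,G_2\rangle_{HS(V,W)}=\sum_i\langle G_1v_i,G_2v_i\rangle_W$, where $(v_i)$ is any orthonormal basis of $V$ (equivalently $\mathrm{Tr}(G_1^*R_WG_2R_V^{-1})$). $\mathbb K^{q\times p}$ carries the Frobenius inner product $\langle X,Y\rangle_F=\mathrm{Tr}(X^*Y)$. For a finite-dimensional inner product space $Z$ over $\mathbb K$, a random linear map $\Theta:Z\to\mathbb K^k$ is called a $(\varepsilon,\delta,d)$ oblivious $Z\to\mathbb K^k$ subspace embedding if for every (deterministic) subspace $Z_d\subset Z$ with $\dim Z_d=d$, $$\mathbb P\big(\forall x,y\in Z_d:\ |\langle x,y\rangle_Z-\langle\Theta(x),\Theta(y)\rangle_2|\le\varepsilon\|x\|_Z\|y\|_Z\big)\ge 1-\delta .$$ *)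

theory Defs
  imports "HOL-Probability.Probability" "Jordan_Normal_Form.Conjugate"
begin

text \<open>
  The scalar field \<open>\<bbbK> \<in> {\<real>, \<complex>}\<close>. By the Gelfand--Mazur theorem, every \<^class>\<open>real_normed_field\<close> is
  isometrically isomorphic to \<open>\<real>\<close> or \<open>\<complex>\<close>, and the axiom below then forces \<^const>\<open>conjugate\<close> to be the
  identity and complex conjugation, respectively. So the class has, up to isomorphism, exactly the
  two members declared as instances.
\<close>

class real_or_complex = real_normed_field + conjugatable_field +
  assumes mult_conjugate_scaleR: "x * conjugate x = (norm x)\<^sup>2 *\<^sub>R 1"

lemma mult_conjugate_norm: "x * conjugate x = of_real ((norm x)\<^sup>2)"
  for x :: "'k::real_or_complex"
  by (simp add: of_real_def mult_conjugate_scaleR)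

instance real :: real_or_complex
  by standard (simp add: power2_eq_square)

instance complex :: real_or_complex
  by standard
    (simp only: conjugate_complex_def complex_norm_square scaleR_conv_of_real mult_1_right)

definition adjoint_matrix :: "'k::conjugatable_field^'n^'m \<Rightarrow> 'k^'m^'n" where
  "adjoint_matrix A = (\<chi> i j. conjugate (A $ j $ i))"

definition dot :: "'k::conjugatable_field^'n \<Rightarrow> 'k^'n \<Rightarrow> 'k" where
  "dot x y = (\<Sum>i\<in>UNIV. conjugate (x $ i) * y $ i)"

definition weighted_inner :: "'k::conjugatable_field^'n^'n \<Rightarrow> 'k^'n \<Rightarrow> 'k^'n \<Rightarrow> 'k" where
  "weighted_inner R x y = dot x (R *v y)"

definition self_adjoint_pos_def :: "'k::real_or_complex^'n^'n \<Rightarrow> bool" where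
  "self_adjoint_pos_def R \<longleftrightarrow>
     adjoint_matrix R = R \<and> (\<forall>x. x \<noteq> 0 \<longrightarrow> (\<exists>r>0. weighted_inner R x x = of_real r))"

text \<open>
  Matrices \<open>'k^'n^'m\<close> (\<open>m\<close> rows, \<open>n\<close> columns) form a vector space over \<open>'k\<close>; the library only
  provides the scalar multiplication \<open>(*s)\<close> of vectors.
\<close>

definition matrix_scale :: "'k::field \<Rightarrow> 'k^'n^'m \<Rightarrow> 'k^'n^'m" where
  "matrix_scale c A = (\<chi> i j. c * A $ i $ j)"

lemma vector_space_matrix_scale:
  "vector_space (matrix_scale :: 'k::field \<Rightarrow> 'k^'n^'m \<Rightarrow> 'k^'n^'m)"
  by unfold_locales (simp_all add: matrix_scale_def vec_eq_iff algebra_simps)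

definition frobenius_inner :: "'k::conjugatable_field^'p^'q \<Rightarrow> 'k^'p^'q \<Rightarrow> 'k" where
  "frobenius_inner X Y = trace (adjoint_matrix X ** Y)"

definition orthonormal_basis :: "'k::conjugatable_field^'n^'n \<Rightarrow> ('n \<Rightarrow> 'k^'n) \<Rightarrow> bool" where
  "orthonormal_basis R v \<longleftrightarrow>
     (\<forall>i j. weighted_inner R (v i) (v j) = (if i = j then 1 else 0)) \<and> vec.span (range v) = UNIV"

text \<open>
  The choice of the orthonormal basis of \<open>V\<close> is immaterial, see \<open>orthonormal_basis_exists\<close>,
  \<open>hs_inner_eq_sum\<close> and \<open>hs_inner_eq_trace\<close> below.
\<close>

definition hs_inner ::
  "'k::conjugatable_field^'v^'v \<Rightarrow> 'k^'w^'w \<Rightarrow> 'k^'v^'w \<Rightarrow> 'k^'v^'w \<Rightarrow> 'k" where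
  "hs_inner R\<^sub>V R\<^sub>W G\<^sub>1 G\<^sub>2 =
     (let v = (SOME v. orthonormal_basis R\<^sub>V v)
      in \<Sum>i\<in>UNIV. weighted_inner R\<^sub>W (G\<^sub>1 *v v i) (G\<^sub>2 *v v i))"

text \<open>
  An inner product space over \<open>'k\<close> is given by its scalar multiplication \<open>s\<close> and its inner product
  \<open>ip\<close> on a whole type; its norm is \<open>sqrt (norm (ip x x))\<close>, as \<open>ip x x\<close> is a nonnegative real scalar.

  A random linear map is linear for every outcome and a \<open>'k^'m\<close>-valued random variable at every
  vector. The event below is then measurable: its condition is closed in \<open>(x, y)\<close>, so it may be tested
  on a countable dense subset of \<open>Z \<times> Z\<close>.
\<close>

definition random_linear_map ::
  "'o measure \<Rightarrow> ('k::real_or_complex \<Rightarrow> 'z::ab_group_add \<Rightarrow> 'z) \<Rightarrow> ('o \<Rightarrow> 'z \<Rightarrow> 'k^'m) \<Rightarrow> bool" where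
  "random_linear_map M s \<Theta> \<longleftrightarrow>
     (\<forall>\<omega>\<in>space M. Vector_Spaces.linear s (*s) (\<Theta> \<omega>)) \<and>
     (\<forall>x. (\<lambda>\<omega>. \<Theta> \<omega> x) \<in> borel_measurable M)"

definition oblivious_subspace_embedding ::
  "'o measure \<Rightarrow> ('k::real_or_complex \<Rightarrow> 'z::ab_group_add \<Rightarrow> 'z) \<Rightarrow> ('z \<Rightarrow> 'z \<Rightarrow> 'k) \<Rightarrow>
   real \<Rightarrow> real \<Rightarrow> nat \<Rightarrow> ('o \<Rightarrow> 'z \<Rightarrow> 'k^'m) \<Rightarrow> bool" where
  "oblivious_subspace_embedding M s ip \<epsilon> \<delta> d \<Theta> \<longleftrightarrow>
     random_linear_map M s \<Theta> \<and>
     (\<forall>Z. module.subspace s Z \<and> vector_space.dim s Z = d \<longrightarrow>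
        measure M {\<omega> \<in> space M. \<forall>x\<in>Z. \<forall>y\<in>Z.
          norm (ip x y - dot (\<Theta> \<omega> x) (\<Theta> \<omega> y)) \<le> \<epsilon> * sqrt (norm (ip x x)) * sqrt (norm (ip y y))}
        \<ge> 1 - \<delta>)"


subsection \<open>Well-definedness of the Hilbert--Schmidt inner product\<close>

lemma dot_add_right: "dot x (y + z) = dot x y + dot x z"
  by (simp add: dot_def algebra_simps sum.distrib)

lemma dot_scale_right: "dot x (c *s y) = c * dot x y"
  by (simp add: dot_def algebra_simps sum_distrib_left)

lemma conjugate_dot: "conjugate (dot x y) = dot y x"
  by (simp add: dot_def sum_conjugate conjugate_dist_mul mult.commute)

lemma dot_adjoint: "dot (A *v x) y = dot x (adjoint_matrix A *v y)"
proof -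
  have "dot (A *v x) y = (\<Sum>i\<in>UNIV. \<Sum>j\<in>UNIV. conjugate (A $ i $ j) * conjugate (x $ j) * y $ i)"
    by (simp add: dot_def matrix_vector_mult_def sum_conjugate conjugate_dist_mul sum_distrib_right)
  also have "\<dots> = (\<Sum>j\<in>UNIV. \<Sum>i\<in>UNIV. conjugate (A $ i $ j) * conjugate (x $ j) * y $ i)"
    by (rule sum.swap)
  also have "\<dots> = dot x (adjoint_matrix A *v y)"
    by (simp add: dot_def adjoint_matrix_def matrix_vector_mult_def sum_distrib_left mult_ac)
  finally show ?thesis .
qed

lemma adjoint_adjoint [simp]: "adjoint_matrix (adjoint_matrix A) = A"
  by (simp add: adjoint_matrix_def vec_eq_iff)

lemma weighted_inner_add_right:
  "weighted_inner R x (y + z) = weighted_inner R x y + weighted_inner R x z"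
  by (simp add: weighted_inner_def dot_add_right matrix_vector_right_distrib)

lemma weighted_inner_scale_right: "weighted_inner R x (c *s y) = c * weighted_inner R x y"
  by (simp add: weighted_inner_def dot_scale_right vector_scalar_commute)

lemma conjugate_weighted_inner:
  assumes "adjoint_matrix R = R"
  shows "conjugate (weighted_inner R x y) = weighted_inner R y x"
  by (simp add: weighted_inner_def conjugate_dot dot_adjoint assms)

lemma orthonormal_basis_exists:
  fixes R :: "'k::real_or_complex^'n^'n"
  assumes R: "self_adjoint_pos_def R"
  shows "\<exists>v. orthonormal_basis R v"
proof -
  let ?ip = "weighted_inner R"
  have sym: "conjugate (?ip x y) = ?ip y x" for x y
    using R by (simp add: conjugate_weighted_inner self_adjoint_pos_def_def)
  have zero_r: "?ip x 0 = 0" for x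
    using weighted_inner_scale_right[of R x 0 0] by simp
  have sum_r: "?ip x (sum f A) = (\<Sum>a\<in>A. ?ip x (f a))" for x f and A :: "('k^'n) set"
    by (induction A rule: infinite_finite_induct) (simp_all add: zero_r weighted_inner_add_right)
  define ON where "ON S \<longleftrightarrow> (\<forall>x\<in>S. \<forall>y\<in>S. ?ip x y = (if x = y then 1 else 0))" for S
  have coeff: "?ip s (\<Sum>t\<in>S. f t *s t) = f s" if "finite S" "ON S" "s \<in> S" for S f s
  proof -
    have "?ip s (\<Sum>t\<in>S. f t *s t) = (\<Sum>t\<in>S. f t * ?ip s t)"
      by (simp add: sum_r weighted_inner_scale_right)
    also have "\<dots> = (\<Sum>t\<in>S. if t = s then f t else 0)"
      using that by (intro sum.cong) (auto simp: ON_def)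
    finally show ?thesis using that by simp
  qed
  have indep: "vec.independent S" if "finite S" "ON S" for S
    using that(1)
  proof (rule vec.independent_if_scalars_zero)
    fix f s assume "(\<Sum>x\<in>S. f x *s x) = 0" "s \<in> S"
    then show "f s = 0" using coeff[OF that, of s f] by (simp add: zero_r)
  qed
  have bound: "card S \<le> CARD('n)" if "finite S" "ON S" for S
    using dim_subset_UNIV_cart_gen[of S] vec.dim_eq_card_independent[OF indep[OF that]] by simp
  have "\<exists>S. (finite S \<and> ON S) \<and> (\<forall>T. finite T \<and> ON T \<longrightarrow> card T \<le> card S)"
    by (rule ex_has_greatest_nat[of _ "{}" card "Suc CARD('n)"])
      (use bound in \<open>auto simp: ON_def less_Suc_eq_le\<close>)
  then obtain S where S: "finite S" "ON S" and max: "\<And>T. finite T \<Longrightarrow> ON T \<Longrightarrow> card T \<le> card S"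
    by blast
  have span: "vec.span S = UNIV"
  proof (rule ccontr)
    assume "vec.span S \<noteq> UNIV"
    then obtain x where x: "x \<notin> vec.span S" by blast
    define p where "p = (\<Sum>s\<in>S. ?ip s x *s s)"
    define y where "y = x - p"
    have p: "p \<in> vec.span S"
      unfolding p_def by (intro vec.span_sum vec.span_scale vec.span_base)
    have "y \<noteq> 0" using x p by (auto simp: y_def)
    then obtain r where r: "r > 0" "?ip y y = of_real r"
      using R by (auto simp: self_adjoint_pos_def_def)
    have sy: "?ip s y = 0" if "s \<in> S" for s
    proof -
      have "?ip s x = ?ip s (y + p)" by (simp add: y_def)
      also have "\<dots> = ?ip s y + ?ip s x"
        using coeff[OF S that, of "\<lambda>s. ?ip s x"] by (simp add: weighted_inner_add_right p_def)
      finally show ?thesis by simp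
    qed
    define c :: 'k where "c = of_real (1 / sqrt r)"
    have cc: "c * conjugate c * of_real r = 1"
    proof -
      have "norm c = 1 / sqrt r" using r(1) by (simp add: c_def norm_divide)
      then have "(norm c)\<^sup>2 * r = 1" using r(1) by (simp add: power_divide)
      then have "of_real ((norm c)\<^sup>2 * r) = (1::'k)" by simp
      then show ?thesis by (simp only: mult_conjugate_norm of_real_mult)
    qed
    define z where "z = c *s y"
    have sz: "?ip s z = 0" "?ip z s = 0" if "s \<in> S" for s
      using sy[OF that] sym[of s z] by (simp_all add: z_def weighted_inner_scale_right)
    have yz: "?ip y z = c * ?ip y y"
      unfolding z_def by (rule weighted_inner_scale_right)
    have zy: "?ip z y = conjugate c * ?ip y y"
      using sym[of y z] by (simp add: yz conjugate_dist_mul sym)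
    have "?ip z z = c * ?ip z y"
      by (subst (2) z_def) (rule weighted_inner_scale_right)
    also have "\<dots> = c * conjugate c * of_real r" by (simp add: zy r(2) mult.assoc)
    also have "\<dots> = 1" by (rule cc)
    finally have zz: "?ip z z = 1" .
    have zS: "z \<notin> S" using sz zz by force
    have "ON (insert z S)"
      using S(2) sz zz zS by (auto simp: ON_def)
    with max[of "insert z S"] S(1) zS show False by simp
  qed
  have "card S = CARD('n)"
    by (metis indep[OF S] span vec.dim_eq_card_independent vec.dim_span vec_dim_card)
  then obtain v :: "'n \<Rightarrow> 'k^'n" where v: "bij_betw v UNIV S"
    using finite_same_card_bij[of "UNIV::'n set" S] S(1) by auto
  have "orthonormal_basis R v"
    unfolding orthonormal_basis_def
  proof (intro conjI allI)
    fix i j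
    have "v i \<in> S" "v j \<in> S" "v i = v j \<longleftrightarrow> i = j"
      using v by (auto simp: bij_betw_def inj_eq)
    then show "?ip (v i) (v j) = (if i = j then 1 else 0)"
      using S(2) by (auto simp: ON_def)
  qed (use v span in \<open>simp add: bij_betw_def\<close>)
  then show ?thesis by blast
qed

lemma hs_sum_eq_trace:
  fixes R\<^sub>V :: "'k::conjugatable_field^'v^'v" and R\<^sub>W :: "'k^'w^'w"
  assumes "orthonormal_basis R\<^sub>V v"
  shows "(\<Sum>i\<in>UNIV. weighted_inner R\<^sub>W (G\<^sub>1 *v v i) (G\<^sub>2 *v v i)) =
         trace (adjoint_matrix G\<^sub>1 ** R\<^sub>W ** G\<^sub>2 ** matrix_inv R\<^sub>V)"
proof -
  define B :: "'k^'v^'v" where "B = (\<chi> a i. v i $ a)"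
  have entry: "(adjoint_matrix B ** (A ** B)) $ i $ j = dot (v i) (A *v v j)" for A i j
    by (simp add: B_def adjoint_matrix_def matrix_matrix_mult_def matrix_vector_mult_def dot_def)
  have "adjoint_matrix B ** (R\<^sub>V ** B) = mat 1"
    using assms by (simp add: vec_eq_iff entry orthonormal_basis_def weighted_inner_def mat_def)
  then have "R\<^sub>V ** B ** adjoint_matrix B = mat 1"
    using matrix_left_right_inverse by blast
  then have inv1: "R\<^sub>V ** (B ** adjoint_matrix B) = mat 1"
    by (simp add: matrix_mul_assoc)
  then have inv2: "(B ** adjoint_matrix B) ** R\<^sub>V = mat 1"
    using matrix_left_right_inverse by blast
  have inv: "matrix_inv R\<^sub>V = B ** adjoint_matrix B"
  proof -
    have "R\<^sub>V ** matrix_inv R\<^sub>V = mat 1 \<and> matrix_inv R\<^sub>V ** R\<^sub>V = mat 1"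
      unfolding matrix_inv_def by (rule someI_ex) (use inv1 inv2 in blast)
    then have "matrix_inv R\<^sub>V = (B ** adjoint_matrix B) ** R\<^sub>V ** matrix_inv R\<^sub>V"
      by (simp add: inv2)
    also have "\<dots> = (B ** adjoint_matrix B) ** (R\<^sub>V ** matrix_inv R\<^sub>V)"
      by (simp add: matrix_mul_assoc)
    also have "R\<^sub>V ** matrix_inv R\<^sub>V = mat 1"
      using \<open>R\<^sub>V ** matrix_inv R\<^sub>V = mat 1 \<and> _\<close> by simp
    finally show ?thesis by simp
  qed
  let ?A = "adjoint_matrix G\<^sub>1 ** R\<^sub>W ** G\<^sub>2"
  have "(\<Sum>i\<in>UNIV. weighted_inner R\<^sub>W (G\<^sub>1 *v v i) (G\<^sub>2 *v v i)) = (\<Sum>i\<in>UNIV. dot (v i) (?A *v v i))"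
    by (simp add: weighted_inner_def dot_adjoint matrix_vector_mul_assoc matrix_mul_assoc)
  also have "\<dots> = trace (adjoint_matrix B ** (?A ** B))"
    by (simp add: trace_def entry)
  also have "\<dots> = trace (?A ** matrix_inv R\<^sub>V)"
    by (subst trace_mul_sym) (simp add: inv matrix_mul_assoc)
  finally show ?thesis .
qed

lemma hs_inner_eq_trace:
  assumes "self_adjoint_pos_def R\<^sub>V"
  shows "hs_inner R\<^sub>V R\<^sub>W G\<^sub>1 G\<^sub>2 = trace (adjoint_matrix G\<^sub>1 ** R\<^sub>W ** G\<^sub>2 ** matrix_inv R\<^sub>V)"
  unfolding hs_inner_def Let_def
  by (rule hs_sum_eq_trace[OF someI_ex[OF orthonormal_basis_exists[OF assms]]])

lemma hs_inner_eq_sum: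
  assumes "self_adjoint_pos_def R\<^sub>V" "orthonormal_basis R\<^sub>V v"
  shows "hs_inner R\<^sub>V R\<^sub>W G\<^sub>1 G\<^sub>2 = (\<Sum>i\<in>UNIV. weighted_inner R\<^sub>W (G\<^sub>1 *v v i) (G\<^sub>2 *v v i))"
  by (rule trans[OF hs_inner_eq_trace[OF assms(1)] hs_sum_eq_trace[OF assms(2), symmetric]])

end

theory Submission
  imports Defs
begin

text \<open>
  The map \<open>J G = Q\<^sub>W G R\<^sub>V\<^sup>-\<^sup>1 Q\<^sub>V\<^sup>*\<close> is a linear isometry of \<open>HS(V, W)\<close> into \<open>\<bbbK>\<^sup>q\<^sup>\<times>\<^sup>p\<close> with the Frobenius
  inner product: after cyclic permutation under the trace, \<open>Q\<^sub>W\<^sup>* Q\<^sub>W\<close> becomes \<open>R\<^sub>W\<close>, and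
  \<open>R\<^sub>V\<^sup>-\<^sup>1 Q\<^sub>V\<^sup>* Q\<^sub>V\<close> cancels (\<open>frobenius_inner_weighted_map\<close>). It is injective because
  \<open>Q\<^sub>W\<^sup>* (J G) Q\<^sub>V = R\<^sub>W G\<close> and \<open>R\<^sub>W\<close> is invertible (\<open>inj_weighted_map\<close>), and hence sends a
  \<open>d\<close>-dimensional subspace \<open>Z\<close> to the \<open>d\<close>-dimensional subspace \<open>J Z\<close>. The event that
  \<open>\<Upsilon> \<circ> J\<close> distorts inner products on \<open>Z\<close> by at most \<open>\<epsilon>\<close> is literally the event that \<open>\<Upsilon>\<close> does so on
  \<open>J Z\<close>, so the bound on its probability carries over
  (\<open>oblivious_subspace_embedding_comp_isometry\<close>).
\<close>

lemma dim_image_inj_linear: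
  assumes f: "Vector_Spaces.linear s1 s2 f" and inj: "inj f"
    and Z: "module.subspace s1 Z"
  shows "vector_space.dim s2 (f ` Z) = vector_space.dim s1 Z"
proof -
  interpret Vector_Spaces.linear s1 s2 f by (rule f)
  obtain B where B: "B \<subseteq> Z" "vs1.independent B" "Z \<subseteq> vs1.span B" "card B = vs1.dim Z"
    by (rule vs1.basis_exists)
  have "vs1.span B = Z"
    using B Z vs1.span_minimal by blast
  then have "vs2.span (f ` B) = vs2.span (f ` Z)"
    by (metis span_image vs2.span_span)
  moreover have "vs2.independent (f ` B)"
    using B(2) inj by (rule independent_inj_image)
  ultimately have "vs2.dim (f ` Z) = card (f ` B)"
    by (rule vs2.dim_eq_card)
  also have "\<dots> = vs1.dim Z"
    using B(4) inj by (metis card_image inj_on_subset subset_UNIV)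
  finally show ?thesis .
qed

text \<open>
  The two probabilities agree because the events do: the one for \<open>\<Upsilon> \<circ> J\<close> and \<open>Z\<close> and the one for
  \<open>\<Upsilon>\<close> and \<open>J ` Z\<close> are the same set of outcomes. Injectivity makes \<open>J ` Z\<close> again
  \<open>d\<close>-dimensional.
\<close>

lemma oblivious_subspace_embedding_comp_isometry:
  fixes s1 :: "'k::real_or_complex \<Rightarrow> 'z::ab_group_add \<Rightarrow> 'z"
    and s2 :: "'k \<Rightarrow> 'y::ab_group_add \<Rightarrow> 'y"
  assumes J: "Vector_Spaces.linear s1 s2 J" "inj J"
    and isometry: "\<And>x y. ip2 (J x) (J y) = ip1 x y"
    and \<Upsilon>: "oblivious_subspace_embedding M s2 ip2 \<epsilon> \<delta> d \<Upsilon>"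
  shows "oblivious_subspace_embedding M s1 ip1 \<epsilon> \<delta> d (\<lambda>\<omega> x. \<Upsilon> \<omega> (J x))"
  unfolding oblivious_subspace_embedding_def
proof (intro conjI allI impI)
  show "random_linear_map M s1 (\<lambda>\<omega> x. \<Upsilon> \<omega> (J x))"
    using \<Upsilon>
    by (auto simp: oblivious_subspace_embedding_def random_linear_map_def
        intro: Vector_Spaces.linear_compose[OF J(1), unfolded o_def])
next
  fix Z assume Z: "module.subspace s1 Z \<and> vector_space.dim s1 Z = d"
  interpret Vector_Spaces.linear s1 s2 J by (rule J)
  have "vs2.subspace (J ` Z)" "vs2.dim (J ` Z) = d"
    using Z dim_image_inj_linear[OF J] by (auto intro: subspace_image)
  then have "measure M {\<omega> \<in> space M. \<forall>x\<in>J ` Z. \<forall>y\<in>J ` Z.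
      norm (ip2 x y - dot (\<Upsilon> \<omega> x) (\<Upsilon> \<omega> y)) \<le> \<epsilon> * sqrt (norm (ip2 x x)) * sqrt (norm (ip2 y y))}
    \<ge> 1 - \<delta>"
    using \<Upsilon> unfolding oblivious_subspace_embedding_def by blast
  then show "measure M {\<omega> \<in> space M. \<forall>x\<in>Z. \<forall>y\<in>Z.
      norm (ip1 x y - dot (\<Upsilon> \<omega> (J x)) (\<Upsilon> \<omega> (J y)))
        \<le> \<epsilon> * sqrt (norm (ip1 x x)) * sqrt (norm (ip1 y y))} \<ge> 1 - \<delta>"
    by (simp add: isometry)
qed

lemma adjoint_matrix_mult:
  "adjoint_matrix (A ** B) = adjoint_matrix B ** adjoint_matrix A"
  by (simp add: adjoint_matrix_def matrix_matrix_mult_def vec_eq_iff sum_conjugate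
      conjugate_dist_mul mult.commute)

lemma adjoint_matrix_mat_1: "adjoint_matrix (mat 1) = (mat 1 :: 'k::conjugatable_field^'n^'n)"
  by (metis adjoint_adjoint adjoint_matrix_mult matrix_mul_rid)

lemma matrix_mult_inv:
  fixes A :: "'k::field^'n^'n"
  assumes "invertible A"
  shows "A ** matrix_inv A = mat 1" "matrix_inv A ** A = mat 1"
  using someI_ex[OF assms[unfolded invertible_def]] by (simp_all add: matrix_inv_def)

lemma adjoint_matrix_inv:
  fixes R :: "'k::conjugatable_field^'n^'n"
  assumes "invertible R" "adjoint_matrix R = R"
  shows "adjoint_matrix (matrix_inv R) = matrix_inv R"
proof -
  let ?S = "matrix_inv R"
  have "adjoint_matrix ?S ** R = adjoint_matrix (R ** ?S)"
    by (simp add: adjoint_matrix_mult assms(2))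
  then have left: "adjoint_matrix ?S ** R = mat 1"
    by (simp add: matrix_mult_inv(1)[OF assms(1)] adjoint_matrix_mat_1)
  have "adjoint_matrix ?S = adjoint_matrix ?S ** (R ** ?S)"
    by (simp add: matrix_mult_inv(1)[OF assms(1)])
  also have "\<dots> = (adjoint_matrix ?S ** R) ** ?S"
    by (rule matrix_mul_assoc)
  also have "\<dots> = ?S"
    by (simp add: left)
  finally show ?thesis .
qed

lemma invertible_self_adjoint_pos_def:
  assumes "self_adjoint_pos_def R"
  shows "invertible R"
proof -
  have "x = 0" if "R *v x = 0" for x
  proof (rule ccontr)
    assume "x \<noteq> 0"
    then obtain r where "r > 0" "weighted_inner R x x = of_real r"
      using assms by (auto simp: self_adjoint_pos_def_def)
    then show False using that by (simp add: weighted_inner_def dot_def)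
  qed
  then show ?thesis
    unfolding invertible_left_inverse matrix_left_invertible_ker by blast
qed

lemma linear_matrix_scale_mult:
  fixes A :: "'k::field^'n^'m" and B :: "'k^'p^'q"
  shows "Vector_Spaces.linear matrix_scale matrix_scale (\<lambda>X. A ** X ** B)"
proof (intro Vector_Spaces.linear_iff[THEN iffD2] conjI allI vector_space_matrix_scale)
  show "A ** (X + Y) ** B = A ** X ** B + A ** Y ** B" for X Y
    by (simp add: matrix_add_ldistrib vec_eq_iff matrix_matrix_mult_def algebra_simps sum.distrib)
  show "A ** matrix_scale c X ** B = matrix_scale c (A ** X ** B)" for c X
    by (simp add: matrix_scale_def vec_eq_iff matrix_matrix_mult_def sum_distrib_left
        sum_distrib_right mult_ac)
qed

text \<open>
  Cycling the last factor \<open>Q\<^sub>V\<^sup>*\<close> of the trace to the front puts \<open>Q\<^sub>V\<^sup>* Q\<^sub>V = R\<^sub>V\<close> next to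
  \<open>R\<^sub>V\<^sup>-\<^sup>1\<close>, and what remains is the trace form of the Hilbert--Schmidt inner product.
\<close>

lemma frobenius_inner_weighted_map:
  fixes R\<^sub>V :: "'k::real_or_complex^'v^'v" and R\<^sub>W :: "'k^'w^'w"
    and Q\<^sub>V :: "'k^'v^'p" and Q\<^sub>W :: "'k^'w^'q"
  assumes R: "self_adjoint_pos_def R\<^sub>V"
    and QV: "adjoint_matrix Q\<^sub>V ** Q\<^sub>V = R\<^sub>V" and QW: "adjoint_matrix Q\<^sub>W ** Q\<^sub>W = R\<^sub>W"
  shows "frobenius_inner (Q\<^sub>W ** G ** matrix_inv R\<^sub>V ** adjoint_matrix Q\<^sub>V)
           (Q\<^sub>W ** H ** matrix_inv R\<^sub>V ** adjoint_matrix Q\<^sub>V) = hs_inner R\<^sub>V R\<^sub>W G H"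
proof -
  let ?S = "matrix_inv R\<^sub>V"
  let ?T = "adjoint_matrix G ** R\<^sub>W ** H ** ?S"
  note inv = invertible_self_adjoint_pos_def[OF R]
  have S: "adjoint_matrix ?S = ?S"
    using R by (intro adjoint_matrix_inv inv) (simp add: self_adjoint_pos_def_def)
  have "frobenius_inner (Q\<^sub>W ** G ** ?S ** adjoint_matrix Q\<^sub>V) (Q\<^sub>W ** H ** ?S ** adjoint_matrix Q\<^sub>V)
      = trace ((Q\<^sub>V ** ?S ** ?T) ** adjoint_matrix Q\<^sub>V)"
    unfolding frobenius_inner_def
    by (simp add: adjoint_matrix_mult S QW[symmetric] matrix_mul_assoc)
  also have "\<dots> = trace ((adjoint_matrix Q\<^sub>V ** Q\<^sub>V) ** ?S ** ?T)"
    by (subst trace_mul_sym) (simp add: matrix_mul_assoc)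
  also have "\<dots> = trace ?T"
    by (simp add: QV matrix_mult_inv(1)[OF inv])
  also have "\<dots> = hs_inner R\<^sub>V R\<^sub>W G H"
    by (rule hs_inner_eq_trace[OF R, symmetric])
  finally show ?thesis .
qed

text \<open>
  The map has the left inverse \<open>Y \<mapsto> R\<^sub>W\<^sup>-\<^sup>1 Q\<^sub>W\<^sup>* Y Q\<^sub>V\<close>.
\<close>

lemma inj_weighted_map:
  fixes R\<^sub>V :: "'k::real_or_complex^'v^'v" and R\<^sub>W :: "'k^'w^'w"
    and Q\<^sub>V :: "'k^'v^'p" and Q\<^sub>W :: "'k^'w^'q"
  assumes RV: "invertible R\<^sub>V" and RW: "invertible R\<^sub>W"
    and QV: "adjoint_matrix Q\<^sub>V ** Q\<^sub>V = R\<^sub>V" and QW: "adjoint_matrix Q\<^sub>W ** Q\<^sub>W = R\<^sub>W"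
  shows "inj (\<lambda>G. Q\<^sub>W ** G ** matrix_inv R\<^sub>V ** adjoint_matrix Q\<^sub>V)" (is "inj ?J")
proof (rule inj_on_inverseI)
  fix G
  have "matrix_inv R\<^sub>W ** (adjoint_matrix Q\<^sub>W ** ?J G ** Q\<^sub>V)
      = (matrix_inv R\<^sub>W ** (adjoint_matrix Q\<^sub>W ** Q\<^sub>W)) ** G
          ** (matrix_inv R\<^sub>V ** (adjoint_matrix Q\<^sub>V ** Q\<^sub>V))"
    by (simp only: matrix_mul_assoc)
  also have "\<dots> = G"
    by (simp add: QV QW matrix_mult_inv(2) RV RW)
  finally show "matrix_inv R\<^sub>W ** (adjoint_matrix Q\<^sub>W ** ?J G ** Q\<^sub>V) = G" .
qed

theorem proposition3p9:
  fixes R\<^sub>V :: "'k::real_or_complex^'v^'v" and R\<^sub>W :: "'k^'w^'w"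
    and Q\<^sub>V :: "'k^'v^'p" and Q\<^sub>W :: "'k^'w^'q"
    and M :: "'o measure" and \<Upsilon> :: "'o \<Rightarrow> 'k^'p^'q \<Rightarrow> 'k^'m"
    and \<epsilon> \<delta> :: real and d :: nat
  assumes "self_adjoint_pos_def R\<^sub>V" and "self_adjoint_pos_def R\<^sub>W"
    and "adjoint_matrix Q\<^sub>V ** Q\<^sub>V = R\<^sub>V" and "adjoint_matrix Q\<^sub>W ** Q\<^sub>W = R\<^sub>W"
    and "prob_space M"
    and "oblivious_subspace_embedding M matrix_scale frobenius_inner \<epsilon> \<delta> d \<Upsilon>"
  shows "oblivious_subspace_embedding M matrix_scale (hs_inner R\<^sub>V R\<^sub>W) \<epsilon> \<delta> d
           (\<lambda>\<omega> G. \<Upsilon> \<omega> (Q\<^sub>W ** G ** matrix_inv R\<^sub>V ** adjoint_matrix Q\<^sub>V))"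
proof (rule oblivious_subspace_embedding_comp_isometry[OF _ _ _ assms(6)])
  show "Vector_Spaces.linear matrix_scale matrix_scale
      (\<lambda>G. Q\<^sub>W ** G ** matrix_inv R\<^sub>V ** adjoint_matrix Q\<^sub>V)"
    using linear_matrix_scale_mult[of Q\<^sub>W "matrix_inv R\<^sub>V ** adjoint_matrix Q\<^sub>V"]
    by (simp add: matrix_mul_assoc)
  show "inj (\<lambda>G. Q\<^sub>W ** G ** matrix_inv R\<^sub>V ** adjoint_matrix Q\<^sub>V)"
    by (intro inj_weighted_map[where R\<^sub>W = R\<^sub>W] invertible_self_adjoint_pos_def assms)
qed (rule frobenius_inner_weighted_map[OF assms(1,3,4)])

end
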